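(* Let $A$ be a set of positive integers with $|A|=5$. Then $\left|4^{\wedge}_{\pm}A\right|\ge 25$. Furthermore, if $\left|4^{\wedge}_{\pm}A\right|=25$, then $A=\min(A)\ast\{1,3,5,7,9\}$.
   Context: For a positive integer $h$ and a finite set of integers $A=\{a_1,\ldots,a_k\}$ (distinct elements), the restricted $h$-fold signed sumset is $h^{\wedge}_{\pm}A=\left\{\sum_{i=1}^k\lambda_i a_i:\lambda_i\in\{-1,0,1\},\ \sum_{i=1}^k|\lambda_i|=h\right\}$. For an integer $c$ and a set $S$ of integers, $c\ast S=\{cs:s\in S\}$. *)

theory Defs
  imports Main
begin

text \<open>Meaningful for finite \<open>A\<close> only. The coefficients are indexed by the elements of \<open>A\<close>
  themselves instead of by an enumeration; values of \<open>l\<close> outside \<open>A\<close> play no role.\<close>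
definition restricted_signed_sumset :: "nat \<Rightarrow> int set \<Rightarrow> int set" where
  "restricted_signed_sumset h A =
    {(\<Sum>a\<in>A. l a * a) | l :: int \<Rightarrow> int.
      (\<forall>a\<in>A. l a \<in> {-1, 0, 1}) \<and> (\<Sum>a\<in>A. \<bar>l a\<bar>) = int h}"

definition dilate :: "int \<Rightarrow> int set \<Rightarrow> int set" where
  "dilate c S = {c * s | s. s \<in> S}"

end

theory Submission
  imports Defs
begin

text \<open>The set \<open>S\<close> of signed sums is symmetric, so a chain of \<open>n\<close> positive signed sums gives
  \<open>2 n\<close> nonzero elements. Let \<open>a < b < c < d < e\<close> be the elements of \<open>A\<close>. Unless they are proportional to
  \<open>1, 3, 5, 7, 9\<close>, there is a chain of 13 positive signed sums, hence \<open>card S \<ge> 26\<close>.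
  Which chain works depends only on the signs of a few linear forms in \<open>a, \<dots>, e\<close>, starting with
  \<open>2 a + c - d\<close>. The tree of case distinctions, which has 16 chains as its other leaves, was
  found by a computer search over the cone \<open>0 < a < b < c < d < e\<close>.\<close>

section \<open>Symmetry and finiteness of the set of signed sums\<close>

lemma uminus_restricted_signed_sumset:
  assumes "x \<in> restricted_signed_sumset h A"
  shows "- x \<in> restricted_signed_sumset h A"
proof -
  from assms obtain l :: "int \<Rightarrow> int" where l: "x = (\<Sum>a\<in>A. l a * a)"
    "\<forall>a\<in>A. l a \<in> {-1, 0, 1}" "(\<Sum>a\<in>A. \<bar>l a\<bar>) = int h"
    unfolding restricted_signed_sumset_def by blast
  then have "- x = (\<Sum>a\<in>A. (- l a) * a)" "\<forall>a\<in>A. - l a \<in> {-1, 0, 1}"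
    "(\<Sum>a\<in>A. \<bar>- l a\<bar>) = int h"
    by (auto simp: sum_negf)
  then show ?thesis
    unfolding restricted_signed_sumset_def by (intro CollectI exI[of _ "\<lambda>a. - l a"]) blast
qed

text \<open>Coefficients of absolute value at most 1 bound every signed sum by the sum of the
  absolute values of the elements. Finiteness is what lets cardinalities be compared along
  inclusions.\<close>

lemma finite_restricted_signed_sumset: "finite (restricted_signed_sumset h A)"
proof (rule finite_subset)
  let ?M = "\<Sum>a\<in>A. \<bar>a\<bar>"
  show "restricted_signed_sumset h A \<subseteq> {- ?M..?M}"
  proof
    fix x assume "x \<in> restricted_signed_sumset h A"
    then obtain l :: "int \<Rightarrow> int" where l: "x = (\<Sum>a\<in>A. l a * a)" "\<forall>a\<in>A. l a \<in> {-1, 0, 1}"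
      unfolding restricted_signed_sumset_def by blast
    have "\<bar>x\<bar> \<le> (\<Sum>a\<in>A. \<bar>l a * a\<bar>)"
      unfolding l(1) by (rule sum_abs)
    also have "\<dots> \<le> ?M"
      using l(2) by (intro sum_mono) force
    finally show "x \<in> {- ?M..?M}" by auto
  qed
qed simp

section \<open>Counting with explicit coefficient vectors\<close>

text \<open>Coefficients are a list aligned with \<open>xs\<close>, so that concrete vectors can be
  evaluated by simplification.\<close>

definition signed_comb :: "int list \<Rightarrow> int list \<Rightarrow> int" where
  "signed_comb xs v = sum_list (map2 (*) v xs)"

text \<open>Lookup in \<open>zip xs v\<close> turns the vector into a coefficient function,
  consistent because the entries of \<open>xs\<close> are distinct; for the same reason sums over
  \<open>set xs\<close> become sums over the list.\<close>

lemma signed_comb_in_restricted_signed_sumset: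
  assumes "distinct xs" "length v = length xs" "set v \<subseteq> {-1, 0, 1}"
    "sum_list (map abs v) = int h"
  shows "signed_comb xs v \<in> restricted_signed_sumset h (set xs)"
proof -
  define l where "l x = the (map_of (zip xs v) x)" for x
  have nth: "l (xs ! i) = v ! i" if "i < length xs" for i
    using that assms(1,2) by (simp add: l_def map_of_zip_nth)
  have map_l: "map l xs = v"
    using assms(2) nth by (intro nth_equalityI) auto
  have "signed_comb xs v = (\<Sum>x\<in>set xs. l x * x)"
    unfolding signed_comb_def sum.distinct_set_conv_list[OF assms(1)]
    by (intro arg_cong[of _ _ sum_list] nth_equalityI) (use assms(2) nth in auto)
  moreover have "\<forall>x\<in>set xs. l x \<in> {-1, 0, 1}"
    using assms(3) map_l by (metis image_eqI list.set_map subsetD)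
  moreover have "(\<Sum>x\<in>set xs. \<bar>l x\<bar>) = int h"
    using assms(4) map_l unfolding sum.distinct_set_conv_list[OF assms(1)]
    by (metis (no_types, lifting) list.map_comp comp_apply map_cong)
  ultimately show ?thesis
    unfolding restricted_signed_sumset_def by blast
qed

text \<open>Starting the chain at 0 makes all its values positive, and by transitivity comparing
  neighbours is enough to make them distinct. Their negatives are signed sums as well and disjoint
  from them. Leaving 0 out allows it to be counted separately.\<close>

lemma card_nonzero_restricted_signed_sumset_ge:
  assumes "distinct xs"
    and "\<forall>v\<in>set vs. length v = length xs \<and> set v \<subseteq> {-1, 0, 1} \<and> sum_list (map abs v) = int h"
    and "successively (<) (0 # map (signed_comb xs) vs)"
  shows "2 * length vs \<le> card (restricted_signed_sumset h (set xs) - {0})"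
proof -
  let ?S = "restricted_signed_sumset h (set xs)"
  define P where "P = set (map (signed_comb xs) vs)"
  have "sorted_wrt (<) (0 # map (signed_comb xs) vs)"
    using assms(3) by (metis successively_conv_sorted_wrt transp_on_less)
  then have pos: "P \<subseteq> {0<..}" and "distinct (map (signed_comb xs) vs)"
    by (auto simp: P_def strict_sorted_iff)
  then have card_P: "card P = length vs"
    by (metis P_def distinct_card length_map)
  have neg: "uminus ` P \<subseteq> {..<0}"
    using pos by auto
  have P_sub: "P \<subseteq> ?S"
    using assms(1,2) signed_comb_in_restricted_signed_sumset by (auto simp: P_def)
  have "2 * length vs = card P + card (uminus ` P)"
    using card_P by (simp add: card_image)
  also have "\<dots> = card (P \<union> uminus ` P)"
    using pos neg by (subst card_Un_disjoint) (simp_all add: P_def disjoint_iff, force)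
  also have "\<dots> \<le> card (?S - {0})"
  proof (rule card_mono)
    show "P \<union> uminus ` P \<subseteq> ?S - {0}"
      using P_sub pos neg uminus_restricted_signed_sumset by blast
  qed (simp add: finite_restricted_signed_sumset)
  finally show ?thesis .
qed

section \<open>Case analysis away from the extremal progression\<close>

lemma card_restricted_signed_sumset_5_generic:
  fixes a b c d e :: int
  assumes le: "0 < a" "a < b" "b < c" "c < d" "d < e"
    and not_AP: "\<not> (b = 3 * a \<and> c = 5 * a \<and> d = 7 * a \<and> e = 9 * a)"
  shows "26 \<le> card (restricted_signed_sumset 4 {a, b, c, d, e} - {0})"
proof -
  \<comment> \<open>For an explicit list the first two premises are evaluated, and the third becomes
    13 linear inequalities that follow from \<open>le\<close> and the case assumptions.\<close>
  have chain: ?thesis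
    if "length vs = 13"
      and "\<forall>v\<in>set vs. length v = 5 \<and> set v \<subseteq> {-1, 0, 1} \<and> sum_list (map abs v) = 4"
      and "successively (<) (0 # map (signed_comb [a, b, c, d, e]) vs)" for vs
    using card_nonzero_restricted_signed_sumset_ge[of "[a, b, c, d, e]" vs 4] that le by simp
  \<comment> \<open>The sign of \<open>2*a + c - d\<close> orders \<open>a + b + c + e\<close>
    against \<open>- a + b + d + e\<close>; on equality they coincide.\<close>
  consider "d < 2*a + c" | "d = 2*a + c" | "d > 2*a + c" by linarith
  then show ?thesis
  proof cases
    case 1
    \<comment> \<open>\<open>b + c - a - d\<close> is itself a signed sum: when nonzero, it or its
      negative opens the chain.\<close>
    consider "a + d < b + c" | "a + d = b + c" | "a + d > b + c" by linarith
    then show ?thesis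
    proof cases
      case 1
      with le \<open>d < 2*a + c\<close> show ?thesis
        by (intro chain[of "[[-1, 1, 1, -1, 0], [-1, 1, 0, -1, 1], [-1, 1, -1, 0, 1], [1, 1, 0, -1, 1],
            [1, 0, 1, -1, 1], [1, -1, 1, 0, 1], [1, -1, 0, 1, 1], [-1, 1, 1, 0, 1],
            [-1, 1, 0, 1, 1], [1, 1, 1, 0, 1], [1, 1, 0, 1, 1], [1, 0, 1, 1, 1],
            [0, 1, 1, 1, 1]]"])
          (simp_all add: signed_comb_def)
    next
      case 2
      with le \<open>d < 2*a + c\<close> show ?thesis
        by (intro chain[of "[[0, -1, 1, -1, 1], [-1, 0, 1, -1, 1], [0, -1, -1, 1, 1], [-1, -1, 1, 0, 1],
            [-1, -1, 0, 1, 1], [1, -1, 1, 0, 1], [1, -1, 0, 1, 1], [-1, 1, 1, 0, 1],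
            [-1, 1, 0, 1, 1], [1, 1, 1, 0, 1], [1, 1, 0, 1, 1], [1, 0, 1, 1, 1],
            [0, 1, 1, 1, 1]]"])
          (simp_all add: signed_comb_def)
    next
      case 3
      with le \<open>d < 2*a + c\<close> show ?thesis
        by (intro chain[of "[[1, -1, -1, 1, 0], [1, -1, -1, 0, 1], [-1, 1, -1, 0, 1], [1, 1, 0, -1, 1],
            [1, 0, 1, -1, 1], [0, 1, 1, -1, 1], [1, -1, 1, 0, 1], [-1, 1, 1, 0, 1],
            [-1, 1, 0, 1, 1], [1, 1, 1, 0, 1], [1, 1, 0, 1, 1], [1, 0, 1, 1, 1],
            [0, 1, 1, 1, 1]]"])
          (simp_all add: signed_comb_def)
    qed
  next
    case 2
    \<comment> \<open>This split orders \<open>a + b + d + e\<close> against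
      \<open>- a + c + d + e\<close>.\<close>
    consider "c < 2*a + b" | "c = 2*a + b" | "c > 2*a + b" by linarith
    then show ?thesis
    proof cases
      case 1
      with le \<open>d = 2*a + c\<close> show ?thesis
        by (intro chain[of "[[-1, 0, 1, -1, 1], [-1, 1, -1, 0, 1], [1, 0, 1, -1, 1], [-1, -1, 1, 0, 1],
            [-1, 0, -1, 1, 1], [-1, -1, 0, 1, 1], [1, 0, -1, 1, 1], [0, 1, -1, 1, 1],
            [-1, 1, 0, 1, 1], [-1, 0, 1, 1, 1], [1, 1, 0, 1, 1], [1, 0, 1, 1, 1],
            [0, 1, 1, 1, 1]]"])
          (simp_all add: signed_comb_def)
    next
      case 2
      \<comment> \<open>Now \<open>b\<close>, \<open>c\<close>, \<open>d\<close> form a progression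
        with difference \<open>2*a\<close>, so only \<open>a\<close>, \<open>b\<close>,
        \<open>e\<close> are free. The remaining splits locate \<open>e\<close> and compare
        \<open>b\<close> with \<open>2*a\<close> and \<open>3*a\<close>.\<close>
      consider "e \<le> a + d" | "e > a + d" by linarith
      then show ?thesis
      proof cases
        case 1
        with le \<open>d = 2*a + c\<close> \<open>c = 2*a + b\<close> show ?thesis
          by (intro chain[of "[[1, 1, -1, 1, 0], [1, 0, 1, -1, 1], [-1, -1, 1, 1, 0], [-1, -1, 1, 0, 1],
              [1, -1, 1, 1, 0], [-1, -1, 0, 1, 1], [0, 1, -1, 1, 1], [-1, 1, 1, 0, 1],
              [1, 1, 1, 1, 0], [-1, 1, 0, 1, 1], [-1, 0, 1, 1, 1], [1, 0, 1, 1, 1],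
              [0, 1, 1, 1, 1]]"])
            (simp_all add: signed_comb_def)
      next
        case 2
        consider "e < b + d" | "e \<ge> b + d" by linarith
        then show ?thesis
        proof cases
          case 1
          consider "d < b + c" | "d \<ge> b + c" by linarith
          then show ?thesis
          proof cases
            case 1
            consider "e \<le> b + c" | "e > b + c" by linarith
            then show ?thesis
            proof cases
              case 1
              with le \<open>d = 2*a + c\<close> \<open>c = 2*a + b\<close> \<open>e > a + d\<close> \<open>e < b + d\<close> \<open>d < b + c\<close> show ?thesis
                by (intro chain[of "[[-1, 1, -1, 1, 0], [1, 1, -1, 1, 0], [-1, -1, 1, 1, 0], [-1, -1, 1, 0, 1],
                    [-1, -1, 0, 1, 1], [1, -1, 0, 1, 1], [0, 1, -1, 1, 1], [-1, 1, 1, 1, 0],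
                    [-1, 1, 1, 0, 1], [-1, 1, 0, 1, 1], [-1, 0, 1, 1, 1], [1, 0, 1, 1, 1],
                    [0, 1, 1, 1, 1]]"])
                  (simp_all add: signed_comb_def)
            next
              case 2
              consider "a + d < b + c" | "a + d = b + c" | "a + d > b + c" by linarith
              then show ?thesis
              proof cases
                case 1
                with le \<open>d = 2*a + c\<close> \<open>c = 2*a + b\<close> \<open>e > a + d\<close> \<open>e < b + d\<close> \<open>d < b + c\<close> \<open>e > b + c\<close> show ?thesis
                  by (intro chain[of "[[-1, 1, 0, -1, 1], [-1, 0, 1, -1, 1], [1, 0, 1, -1, 1], [-1, -1, 1, 0, 1],
                      [-1, -1, 0, 1, 1], [1, -1, 0, 1, 1], [0, 1, -1, 1, 1], [1, 1, 1, 1, 0],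
                      [0, -1, 1, 1, 1], [-1, 1, 0, 1, 1], [-1, 0, 1, 1, 1], [1, 0, 1, 1, 1],
                      [0, 1, 1, 1, 1]]"])
                    (simp_all add: signed_comb_def)
              next
                case 2
                \<comment> \<open>Here \<open>b = 3*a\<close>, \<open>c = 5*a\<close>,
                  \<open>d = 7*a\<close>, and \<open>e\<close> is compared with \<open>9*a\<close>.
                  Cases 1 and 3 use the same 13 vectors with four adjacent pairs swapped; at
                  \<open>e = 9*a\<close> each of these pairs has equal values.\<close>
                consider "a + e < 2*c" | "a + e = 2*c" | "a + e > 2*c" by linarith
                then show ?thesis
                proof cases
                  case 1
                  with le \<open>d = 2*a + c\<close> \<open>c = 2*a + b\<close> \<open>e > a + d\<close> \<open>e < b + d\<close> \<open>d < b + c\<close> \<open>e > b + c\<close> \<open>a + d = b + c\<close> show ?thesis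
                    by (intro chain[of "[[0, -1, -1, 1, 1], [-1, -1, 1, 1, 0], [-1, -1, 1, 0, 1], [1, -1, 1, 1, 0],
                        [-1, -1, 0, 1, 1], [0, 1, -1, 1, 1], [-1, 1, 1, 1, 0], [-1, 1, 1, 0, 1],
                        [1, 1, 1, 1, 0], [-1, 1, 0, 1, 1], [-1, 0, 1, 1, 1], [1, 0, 1, 1, 1],
                        [0, 1, 1, 1, 1]]"])
                      (simp_all add: signed_comb_def)
                next
                  case 2
                  \<comment> \<open>The four equations force the progression excluded by
                    \<open>not_AP\<close>: this is the only leaf without a chain.\<close>
                  with le \<open>d = 2*a + c\<close> \<open>c = 2*a + b\<close> \<open>e > a + d\<close> \<open>e < b + d\<close> \<open>d < b + c\<close> \<open>e > b + c\<close> \<open>a + d = b + c\<close> show ?thesis using not_AP by linarith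
                next
                  case 3
                  with le \<open>d = 2*a + c\<close> \<open>c = 2*a + b\<close> \<open>e > a + d\<close> \<open>e < b + d\<close> \<open>d < b + c\<close> \<open>e > b + c\<close> \<open>a + d = b + c\<close> show ?thesis
                    by (intro chain[of "[[-1, -1, 1, 1, 0], [0, -1, -1, 1, 1], [1, -1, 1, 1, 0], [-1, -1, 1, 0, 1],
                        [-1, -1, 0, 1, 1], [-1, 1, 1, 1, 0], [0, 1, -1, 1, 1], [1, 1, 1, 1, 0],
                        [-1, 1, 1, 0, 1], [-1, 1, 0, 1, 1], [-1, 0, 1, 1, 1], [1, 0, 1, 1, 1],
                        [0, 1, 1, 1, 1]]"])
                      (simp_all add: signed_comb_def)
                qed
              next
                case 3
                with le \<open>d = 2*a + c\<close> \<open>c = 2*a + b\<close> \<open>e > a + d\<close> \<open>e < b + d\<close> \<open>d < b + c\<close> \<open>e > b + c\<close> show ?thesis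
                  by (intro chain[of "[[1, 0, 1, -1, 1], [0, -1, -1, 1, 1], [0, 1, 1, -1, 1], [-1, -1, 1, 0, 1],
                      [-1, -1, 0, 1, 1], [0, 1, -1, 1, 1], [1, -1, 0, 1, 1], [-1, 1, 1, 0, 1],
                      [-1, 1, 0, 1, 1], [0, -1, 1, 1, 1], [-1, 0, 1, 1, 1], [1, 0, 1, 1, 1],
                      [0, 1, 1, 1, 1]]"])
                    (simp_all add: signed_comb_def)
              qed
            qed
          next
            case 2
            with le \<open>d = 2*a + c\<close> \<open>c = 2*a + b\<close> \<open>e > a + d\<close> \<open>e < b + d\<close> show ?thesis
              by (intro chain[of "[[-1, -1, 1, 1, 0], [0, -1, -1, 1, 1], [-1, -1, 1, 0, 1], [1, -1, 1, 1, 0],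
                  [-1, -1, 0, 1, 1], [0, 1, -1, 1, 1], [-1, 1, 1, 0, 1], [1, 1, 1, 1, 0],
                  [-1, 1, 0, 1, 1], [0, -1, 1, 1, 1], [-1, 0, 1, 1, 1], [1, 0, 1, 1, 1],
                  [0, 1, 1, 1, 1]]"])
                (simp_all add: signed_comb_def)
          qed
        next
          case 2
          with le \<open>d = 2*a + c\<close> \<open>c = 2*a + b\<close> \<open>e > a + d\<close> show ?thesis
            by (intro chain[of "[[1, 1, 1, -1, 0], [-1, 1, -1, 1, 0], [0, -1, 1, -1, 1], [-1, 0, 1, -1, 1],
                [1, 0, 1, -1, 1], [-1, -1, 1, 0, 1], [-1, -1, 0, 1, 1], [0, 1, -1, 1, 1],
                [-1, 1, 1, 0, 1], [-1, 1, 0, 1, 1], [-1, 0, 1, 1, 1], [1, 0, 1, 1, 1],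
                [0, 1, 1, 1, 1]]"])
              (simp_all add: signed_comb_def)
        qed
      qed
    next
      case 3
      with le \<open>d = 2*a + c\<close> show ?thesis
        by (intro chain[of "[[-1, 1, 0, -1, 1], [-1, 1, -1, 0, 1], [-1, 0, 1, -1, 1], [1, 0, 1, -1, 1],
            [-1, 0, -1, 1, 1], [-1, -1, 1, 0, 1], [-1, -1, 0, 1, 1], [-1, 1, 1, 0, 1],
            [-1, 1, 0, 1, 1], [1, 1, 0, 1, 1], [-1, 0, 1, 1, 1], [1, 0, 1, 1, 1],
            [0, 1, 1, 1, 1]]"])
          (simp_all add: signed_comb_def)
    qed
  next
    case 3
    \<comment> \<open>Again \<open>a + b + c - d\<close> is a signed sum, and when nonzero it or its
      negative opens the chain.\<close>
    consider "d < a + b + c" | "d = a + b + c" | "d > a + b + c" by linarith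
    then show ?thesis
    proof cases
      case 1
      with le \<open>d > 2*a + c\<close> show ?thesis
        by (intro chain[of "[[1, 1, 1, -1, 0], [-1, 1, 0, -1, 1], [1, 1, 0, -1, 1], [-1, 1, -1, 0, 1],
            [1, 1, -1, 0, 1], [-1, 0, -1, 1, 1], [-1, -1, 0, 1, 1], [1, -1, 0, 1, 1],
            [1, 1, 1, 0, 1], [-1, 1, 0, 1, 1], [-1, 0, 1, 1, 1], [1, 0, 1, 1, 1],
            [0, 1, 1, 1, 1]]"])
          (simp_all add: signed_comb_def)
    next
      case 2
      with le \<open>d > 2*a + c\<close> show ?thesis
        by (intro chain[of "[[-1, 1, 0, -1, 1], [1, 1, 0, -1, 1], [-1, 1, -1, 0, 1], [0, 1, 1, -1, 1],
            [0, -1, -1, 1, 1], [-1, 0, -1, 1, 1], [-1, -1, 0, 1, 1], [-1, 1, 1, 0, 1],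
            [1, 1, 1, 0, 1], [-1, 1, 0, 1, 1], [-1, 0, 1, 1, 1], [1, 0, 1, 1, 1],
            [0, 1, 1, 1, 1]]"])
          (simp_all add: signed_comb_def)
    next
      case 3
      with le \<open>d > 2*a + c\<close> show ?thesis
        by (intro chain[of "[[-1, -1, -1, 1, 0], [-1, -1, -1, 0, 1], [1, -1, -1, 0, 1], [-1, 1, -1, 0, 1],
            [1, 1, -1, 0, 1], [0, -1, -1, 1, 1], [-1, 0, -1, 1, 1], [1, 0, -1, 1, 1],
            [0, 1, -1, 1, 1], [-1, 1, 0, 1, 1], [-1, 0, 1, 1, 1], [1, 0, 1, 1, 1],
            [0, 1, 1, 1, 1]]"])
          (simp_all add: signed_comb_def)
    qed
  qed
qed

section \<open>The extremal progression and the conclusion\<close>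

text \<open>Four odd multiples of \<open>a\<close> add up to an even multiple, at most
  \<open>24 * a\<close> in absolute value, so a chain of 13 is impossible. The 12 vectors give
  \<open>2 * a, 4 * a, ..., 24 * a\<close> in this order, and \<open>3 - 5 - 7 + 9 = 0\<close>
  supplies the 25th element.\<close>

lemma card_restricted_signed_sumset_5_AP:
  fixes a :: int
  assumes "0 < a"
  shows "25 \<le> card (restricted_signed_sumset 4 {a, 3 * a, 5 * a, 7 * a, 9 * a})" (is "_ \<le> card ?S")
proof -
  have "24 \<le> card (?S - {0})"
    using card_nonzero_restricted_signed_sumset_ge[of "[a, 3 * a, 5 * a, 7 * a, 9 * a]"
      "[[-1, 0, 1, 1, -1], [-1, 1, -1, 1, 0], [-1, 0, 1, -1, 1], [-1, -1, 1, 1, 0],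
        [-1, -1, 1, 0, 1], [-1, -1, 0, 1, 1], [-1, 1, 1, 1, 0], [-1, 1, 1, 0, 1],
        [-1, 1, 0, 1, 1], [-1, 0, 1, 1, 1], [1, 0, 1, 1, 1], [0, 1, 1, 1, 1]]" 4] assms
    by (simp add: signed_comb_def)
  moreover have "0 \<in> ?S"
    using signed_comb_in_restricted_signed_sumset[of "[a, 3 * a, 5 * a, 7 * a, 9 * a]"
      "[0, 1, -1, -1, 1]" 4] assms
    by (simp add: signed_comb_def)
  ultimately show ?thesis
    using finite_restricted_signed_sumset by (simp add: card_Diff_singleton)
qed

lemma card_5_obtain_increasing:
  fixes A :: "'a :: linorder set"
  assumes "card A = 5"
  obtains a b c d e where "A = {a, b, c, d, e}" "a < b" "b < c" "c < d" "d < e"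
proof -
  define xs where "xs = sorted_list_of_set A"
  have "finite A"
    using assms card.infinite by fastforce
  then have xs: "set xs = A" "length xs = 5" "sorted_wrt (<) xs"
    using assms by (simp_all add: xs_def)
  then obtain a b c d e where "xs = [a, b, c, d, e]"
    by (auto simp: eval_nat_numeral length_Suc_conv)
  with xs that show ?thesis by auto
qed

theorem theorem3p2:
  fixes A :: "int set"
  assumes "\<forall>a\<in>A. 0 < a"
    and "card A = 5"
  shows "25 \<le> card (restricted_signed_sumset 4 A) \<and>
    (card (restricted_signed_sumset 4 A) = 25 \<longrightarrow> A = dilate (Min A) {1, 3, 5, 7, 9})"
proof -
  obtain a b c d e where A: "A = {a, b, c, d, e}" and le: "a < b" "b < c" "c < d" "d < e"
    using card_5_obtain_increasing[OF assms(2)] .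
  have "0 < a"
    using assms(1) A by simp
  show ?thesis
  \<comment> \<open>For the progression the lower bound suffices, since the conclusion about
    \<open>A\<close> holds outright; otherwise 26 elements rule out equality.\<close>
  proof (cases "b = 3 * a \<and> c = 5 * a \<and> d = 7 * a \<and> e = 9 * a")
    case True
    have "Min A = a"
      unfolding A using le by (intro Min_eqI) auto
    then have "A = dilate (Min A) {1, 3, 5, 7, 9}"
      using True by (auto simp: A dilate_def)
    moreover have "25 \<le> card (restricted_signed_sumset 4 A)"
      using card_restricted_signed_sumset_5_AP[OF \<open>0 < a\<close>] True by (simp add: A)
    ultimately show ?thesis by blast
  next
    case False
    have "26 \<le> card (restricted_signed_sumset 4 A - {0})"
      unfolding A using card_restricted_signed_sumset_5_generic \<open>0 < a\<close> le False by blast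
    also have "\<dots> \<le> card (restricted_signed_sumset 4 A)"
      by (intro card_mono finite_restricted_signed_sumset) auto
    finally show ?thesis by linarith
  qed
qed

end
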